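(* Let $N=(n_1,\dots,n_k)$ be a $k$-tuple of positive integers and let $Q$ be a finite $N$-quandle with (ordered) algebraic components $Q_1,\dots,Q_k$. Then $Conj_N(Q)$ is a finite group, and $$\vert Conj_N(Q)\vert \le n_1^{\vert Q_1\vert}\cdots n_k^{\vert Q_k\vert}.$$
   Context: A quandle is a set $Q$ with two binary operations $\rhd,\rhd^{-1}$ such that for all $x,y,z\in Q$: (A1) $x\rhd x=x$; (A2) $(x\rhd y)\rhd^{-1}y=x=(x\rhd^{-1}y)\rhd y$; (A3) $(x\rhd y)\rhd z=(x\rhd z)\rhd(y\rhd z)$. Write $x^y=x\rhd y$, $x^{\bar y}=x\rhd^{-1}y$, $x^{yz}=(x^y)^z$, and $x^{y^n}=x^{yy\cdots y}$ ($n$ copies of $y$). Two elements $p,q\in Q$ are in the same algebraic component if $p^w=q$ for some word $w$ in the free group on $Q$ (with $\bar x$ representing the inverse of $x$); the components partition $Q$. If $Q$ has $k$ components, ordered $Q_1,\dots,Q_k$, and $N=(n_1,\dots,n_k)$ is a $k$-tuple of positive integers, then $Q$ is an $N$-quandle if $x^{y^{n_i}}=x$ whenever $x\in Q$ and $y\in Q_i$. Suppose $Q$ has a finite presentation $Q=\langle q_1,\dots,q_s\mid r_1,\dots,r_m\rangle$ as a quandle, each relation $r_i$ having the form $q_{a_i}^{w_i}=q_{b_i}$ with $w_i$ a word in the $q_j$'s and $\overline{q_j}$'s. For a quandle relation $r$ of the form $x^w=y$, let $\overline r$ be the group relation $w^{-1}xwy^{-1}=1$ (where $\overline{q_i}$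 is read as $q_i^{-1}$ in $w$). The conjugation group is the group with presentation $Conj(Q)=\langle q_1,\dots,q_s\mid \overline{r_1},\dots,\overline{r_m}\rangle$. If $Q$ is an $N$-quandle and the generator $q_i$ lies in the component $Q_{j_i}$, then $Conj_N(Q)=\langle q_1,\dots,q_s\mid \overline{r_1},\dots,\overline{r_m},q_1^{n_{j_1}},\dots,q_s^{n_{j_s}}\rangle$, the quotient of $Conj(Q)$ by the normal subgroup generated by $q_1^{n_{j_1}},\dots,q_s^{n_{j_s}}$. *)

theory Defs
  imports "HOL-Algebra.Coset"
begin

record 'a quandle = "'a partial_object" +
  rhd :: "'a \<Rightarrow> 'a \<Rightarrow> 'a" (infixl "\<rhd>\<index>" 70)
  rhd_inv :: "'a \<Rightarrow> 'a \<Rightarrow> 'a" (infixl "\<rhd>\<^sup>-\<^sup>1\<index>" 70)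

locale quandle =
  fixes Q (structure)
  assumes rhd_closed: "\<lbrakk>x \<in> carrier Q; y \<in> carrier Q\<rbrakk> \<Longrightarrow> x \<rhd> y \<in> carrier Q"
    and rhd_inv_closed: "\<lbrakk>x \<in> carrier Q; y \<in> carrier Q\<rbrakk> \<Longrightarrow> x \<rhd>\<^sup>-\<^sup>1 y \<in> carrier Q"
    and A1: "x \<in> carrier Q \<Longrightarrow> x \<rhd> x = x"
    and A2: "\<lbrakk>x \<in> carrier Q; y \<in> carrier Q\<rbrakk> \<Longrightarrow> (x \<rhd> y) \<rhd>\<^sup>-\<^sup>1 y = x"
            "\<lbrakk>x \<in> carrier Q; y \<in> carrier Q\<rbrakk> \<Longrightarrow> (x \<rhd>\<^sup>-\<^sup>1 y) \<rhd> y = x"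
    and A3: "\<lbrakk>x \<in> carrier Q; y \<in> carrier Q; z \<in> carrier Q\<rbrakk>
             \<Longrightarrow> (x \<rhd> y) \<rhd> z = (x \<rhd> z) \<rhd> (y \<rhd> z)"

text \<open>\<open>Neg x\<close> is the letter written \<open>x\<close> with a bar (in quandle words) or
  \<open>x\<close> to the power \<open>-1\<close> (in group words). Words need not be reduced.\<close>

datatype 'g letter = Pos 'g | Neg 'g

type_synonym 'g word = "'g letter list"

definition words :: "'g set \<Rightarrow> 'g word set" where
  "words S = {w. \<forall>l \<in> set w. set_letter l \<subseteq> S}"

fun flip_letter :: "'g letter \<Rightarrow> 'g letter" where
  "flip_letter (Pos x) = Neg x"
| "flip_letter (Neg x) = Pos x"

definition word_inv :: "'g word \<Rightarrow> 'g word" where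
  "word_inv w = rev (map flip_letter w)"

text \<open>\<open>qpow Q x w\<close> is \<open>x\<close> to the power \<open>w\<close>, where words act from the right,
  first letter first.\<close>

fun qpow :: "('a, 'm) quandle_scheme \<Rightarrow> 'a \<Rightarrow> 'a word \<Rightarrow> 'a" where
  "qpow Q x [] = x"
| "qpow Q x (Pos y # w) = qpow Q (x \<rhd>\<^bsub>Q\<^esub> y) w"
| "qpow Q x (Neg y # w) = qpow Q (x \<rhd>\<^sup>-\<^sup>1\<^bsub>Q\<^esub> y) w"

definition same_component :: "('a, 'm) quandle_scheme \<Rightarrow> ('a \<times> 'a) set" where
  "same_component Q =
     {(p, q). p \<in> carrier Q \<and> q \<in> carrier Q \<and> (\<exists>w \<in> words (carrier Q). qpow Q p w = q)}"

definition algebraic_components :: "('a, 'm) quandle_scheme \<Rightarrow> 'a set set" where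
  "algebraic_components Q = carrier Q // same_component Q"

definition ordered_components ::
    "('a, 'm) quandle_scheme \<Rightarrow> nat \<Rightarrow> (nat \<Rightarrow> 'a set) \<Rightarrow> bool" where
  "ordered_components Q k C \<longleftrightarrow> bij_betw C {1..k} (algebraic_components Q)"

definition N_quandle ::
    "('a, 'm) quandle_scheme \<Rightarrow> nat \<Rightarrow> (nat \<Rightarrow> 'a set) \<Rightarrow> (nat \<Rightarrow> nat) \<Rightarrow> bool" where
  "N_quandle Q k C n \<longleftrightarrow>
     quandle Q \<and> ordered_components Q k C \<and> (\<forall>i \<in> {1..k}. n i > 0) \<and>
     (\<forall>i \<in> {1..k}. \<forall>y \<in> C i. \<forall>x \<in> carrier Q. qpow Q x (replicate (n i) (Pos y)) = x)"

datatype 'g qterm =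
    Gen 'g
  | Rhd "'g qterm" "'g qterm"
  | RhdInv "'g qterm" "'g qterm"

fun term_pow :: "'g qterm \<Rightarrow> 'g word \<Rightarrow> 'g qterm" where
  "term_pow t [] = t"
| "term_pow t (Pos y # w) = term_pow (Rhd t (Gen y)) w"
| "term_pow t (Neg y # w) = term_pow (RhdInv t (Gen y)) w"

text \<open>The triple \<open>(a, w, b)\<close> stands for the relation saying that \<open>a\<close> to the power \<open>w\<close>
  equals \<open>b\<close>.\<close>

type_synonym 'g qrel = "'g \<times> 'g word \<times> 'g"

text \<open>The least congruence on the terms over \<open>S\<close> whose quotient is a quandle in which the
  relations \<open>R\<close> hold; that quotient is the quandle presented by \<open>S\<close> and \<open>R\<close>.\<close>

inductive qcong :: "'g set \<Rightarrow> 'g qrel set \<Rightarrow> 'g qterm \<Rightarrow> 'g qterm \<Rightarrow> bool"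
  for S :: "'g set" and R :: "'g qrel set" where
  refl: "set_qterm t \<subseteq> S \<Longrightarrow> qcong S R t t"
| sym: "qcong S R t u \<Longrightarrow> qcong S R u t"
| trans: "\<lbrakk>qcong S R t u; qcong S R u v\<rbrakk> \<Longrightarrow> qcong S R t v"
| cong_Rhd: "\<lbrakk>qcong S R t t'; qcong S R u u'\<rbrakk> \<Longrightarrow> qcong S R (Rhd t u) (Rhd t' u')"
| cong_RhdInv: "\<lbrakk>qcong S R t t'; qcong S R u u'\<rbrakk> \<Longrightarrow> qcong S R (RhdInv t u) (RhdInv t' u')"
| A1: "set_qterm t \<subseteq> S \<Longrightarrow> qcong S R (Rhd t t) t"
| A2: "\<lbrakk>set_qterm t \<subseteq> S; set_qterm u \<subseteq> S\<rbrakk> \<Longrightarrow> qcong S R (RhdInv (Rhd t u) u) t"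
| A2': "\<lbrakk>set_qterm t \<subseteq> S; set_qterm u \<subseteq> S\<rbrakk> \<Longrightarrow> qcong S R (Rhd (RhdInv t u) u) t"
| A3: "\<lbrakk>set_qterm t \<subseteq> S; set_qterm u \<subseteq> S; set_qterm v \<subseteq> S\<rbrakk>
       \<Longrightarrow> qcong S R (Rhd (Rhd t u) v) (Rhd (Rhd t v) (Rhd u v))"
| relation: "(a, w, b) \<in> R \<Longrightarrow> qcong S R (term_pow (Gen a) w) (Gen b)"

fun qeval :: "('a, 'm) quandle_scheme \<Rightarrow> ('g \<Rightarrow> 'a) \<Rightarrow> 'g qterm \<Rightarrow> 'a" where
  "qeval Q q (Gen i) = q i"
| "qeval Q q (Rhd t u) = qeval Q q t \<rhd>\<^bsub>Q\<^esub> qeval Q q u"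
| "qeval Q q (RhdInv t u) = qeval Q q t \<rhd>\<^sup>-\<^sup>1\<^bsub>Q\<^esub> qeval Q q u"

text \<open>Sending the generator \<open>i \<in> S\<close> to \<open>q i\<close> induces an isomorphism from the quandle presented
  by \<open>S\<close> and \<open>R\<close> onto \<open>Q\<close>. As usual for presentations, distinct generators may
  denote the same element of \<open>Q\<close>.\<close>

definition presents_quandle ::
    "('a, 'm) quandle_scheme \<Rightarrow> 'g set \<Rightarrow> 'g qrel set \<Rightarrow> ('g \<Rightarrow> 'a) \<Rightarrow> bool" where
  "presents_quandle Q S R q \<longleftrightarrow>
     (\<forall>(a, w, b) \<in> R. a \<in> S \<and> w \<in> words S \<and> b \<in> S) \<and>
     qeval Q q ` {t. set_qterm t \<subseteq> S} = carrier Q \<and>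
     (\<forall>t u. set_qterm t \<subseteq> S \<longrightarrow> set_qterm u \<subseteq> S \<longrightarrow>
        (qeval Q q t = qeval Q q u \<longleftrightarrow> qcong S R t u))"

text \<open>The least congruence on the words over \<open>S\<close> whose quotient is a group in which the
  relators in \<open>T\<close> are trivial.\<close>

inductive gcong :: "'g set \<Rightarrow> 'g word set \<Rightarrow> 'g word \<Rightarrow> 'g word \<Rightarrow> bool"
  for S :: "'g set" and T :: "'g word set" where
  refl: "u \<in> words S \<Longrightarrow> gcong S T u u"
| sym: "gcong S T u v \<Longrightarrow> gcong S T v u"
| trans: "\<lbrakk>gcong S T u v; gcong S T v w\<rbrakk> \<Longrightarrow> gcong S T u w"
| cong_append: "\<lbrakk>gcong S T u u'; gcong S T v v'\<rbrakk> \<Longrightarrow> gcong S T (u @ v) (u' @ v')"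
| cancel: "x \<in> S \<Longrightarrow> gcong S T [Pos x, Neg x] []"
| cancel': "x \<in> S \<Longrightarrow> gcong S T [Neg x, Pos x] []"
| relator: "r \<in> T \<Longrightarrow> gcong S T r []"

definition gclass :: "'g set \<Rightarrow> 'g word set \<Rightarrow> 'g word \<Rightarrow> 'g word set" where
  "gclass S T u = {v. gcong S T u v}"

definition presented_group :: "'g set \<Rightarrow> 'g word set \<Rightarrow> 'g word set monoid" where
  "presented_group S T =
     \<lparr>carrier = gclass S T ` words S,
      mult = (\<lambda>A B. \<Union>a \<in> A. \<Union>b \<in> B. gclass S T (a @ b)),
      one = gclass S T []\<rparr>"

definition conj_relator :: "'g qrel \<Rightarrow> 'g word" where
  "conj_relator = (\<lambda>(x, w, y). word_inv w @ [Pos x] @ w @ [Neg y])"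

definition power_relators ::
    "'g set \<Rightarrow> ('g \<Rightarrow> 'a) \<Rightarrow> nat \<Rightarrow> (nat \<Rightarrow> 'a set) \<Rightarrow> (nat \<Rightarrow> nat) \<Rightarrow> 'g word set" where
  "power_relators S q k C n =
     {replicate (n j) (Pos i) | i j. i \<in> S \<and> j \<in> {1..k} \<and> q i \<in> C j}"

definition Conj_N ::
    "'g set \<Rightarrow> 'g qrel set \<Rightarrow> ('g \<Rightarrow> 'a) \<Rightarrow> nat \<Rightarrow> (nat \<Rightarrow> 'a set) \<Rightarrow> (nat \<Rightarrow> nat)
      \<Rightarrow> 'g word set monoid" where
  "Conj_N S R q k C n = presented_group S (conj_relator ` R \<union> power_relators S q k C n)"

end

theory Submission
  imports Defs "HOL-Algebra.Generated_Groups"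
begin

text \<open>The generators of \<open>Conj_N Q\<close> extend to a map \<open>e\<close> from \<open>Q\<close> to \<open>Conj_N Q\<close> that turns
  \<open>x \<rhd> y\<close> into the conjugate of \<open>e x\<close> by \<open>e y\<close>. Its image is a finite generating set that is
  closed under conjugation, and \<open>e x\<close> to the power \<open>n\<^sub>i\<close> is trivial for \<open>x\<close> in the
  \<open>i\<close>-th component. By Dietzmann's argument, every group element is then an ordered product
  of powers of the \<open>e x\<close>, with the exponent of \<open>e x\<close> below \<open>n\<^sub>i\<close>.\<close>

section \<open>Dietzmann's lemma\<close>

text \<open>Words are lists of indices and not of group elements: the index type brings the order
  used for sorting, and different indices may name the same element.\<close>

definition list_product :: "('b, 'm) monoid_scheme \<Rightarrow> ('i \<Rightarrow> 'b) \<Rightarrow> 'i list \<Rightarrow> 'b" where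
  "list_product G a w = foldr (\<lambda>i g. a i \<otimes>\<^bsub>G\<^esub> g) w \<one>\<^bsub>G\<^esub>"

lemma list_product_Nil [simp]: "list_product G a [] = \<one>\<^bsub>G\<^esub>"
  and list_product_Cons [simp]: "list_product G a (i # w) = a i \<otimes>\<^bsub>G\<^esub> list_product G a w"
  by (simp_all add: list_product_def)

primrec ordered_power_products ::
    "('b, 'm) monoid_scheme \<Rightarrow> ('i \<Rightarrow> 'b) \<Rightarrow> ('i \<Rightarrow> nat) \<Rightarrow> 'i list \<Rightarrow> 'b set" where
  "ordered_power_products G a n [] = {\<one>\<^bsub>G\<^esub>}"
| "ordered_power_products G a n (i # xs) =
     (\<lambda>(c, g). a i [^]\<^bsub>G\<^esub> (c::nat) \<otimes>\<^bsub>G\<^esub> g) ` ({..<n i} \<times> ordered_power_products G a n xs)"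

lemma finite_ordered_power_products: "finite (ordered_power_products G a n xs)"
  by (induction xs) auto

lemma card_ordered_power_products_le:
  "card (ordered_power_products G a n xs) \<le> prod_list (map n xs)"
proof (induction xs)
  case (Cons i xs)
  have "card (ordered_power_products G a n (i # xs))
      \<le> card ({..<n i} \<times> ordered_power_products G a n xs)"
    unfolding ordered_power_products.simps
    by (intro card_image_le finite_cartesian_product finite_ordered_power_products) simp
  also have "\<dots> \<le> n i * prod_list (map n xs)"
    using Cons by (simp add: card_cartesian_product)
  finally show ?case by simp
qed simp

context group
begin

lemma mult_inv_cancel_left [simp]:
  "x \<in> carrier G \<Longrightarrow> y \<in> carrier G \<Longrightarrow> x \<otimes> (inv x \<otimes> y) = y"
  "x \<in> carrier G \<Longrightarrow> y \<in> carrier G \<Longrightarrow> inv x \<otimes> (x \<otimes> y) = y"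
  by (simp_all flip: m_assoc)

lemma list_product_closed [simp, intro]:
  "a ` set w \<subseteq> carrier G \<Longrightarrow> list_product G a w \<in> carrier G"
  by (induction w) auto

lemma list_product_append:
  "a ` set u \<subseteq> carrier G \<Longrightarrow> a ` set v \<subseteq> carrier G \<Longrightarrow>
    list_product G a (u @ v) = list_product G a u \<otimes> list_product G a v"
  by (induction u) (auto simp: m_assoc)

lemma list_product_replicate:
  "a i \<in> carrier G \<Longrightarrow> list_product G a (replicate c i) = a i [^] c"
  by (induction c) (simp_all, metis nat_pow_Suc nat_pow_Suc2)

lemma ordered_power_products_subset:
  "a ` set xs \<subseteq> carrier G \<Longrightarrow> ordered_power_products G a n xs \<subseteq> carrier G"
  by (induction xs) auto

text \<open>In a sorted word the occurrences of a letter are adjacent, so the product is already one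
  of powers in the order of \<open>xs\<close>; torsion brings every exponent below its
  bound.\<close>

lemma list_product_sorted_in_ordered_power_products:
  fixes xs :: "'i::linorder list"
  assumes "sorted w" "set w \<subseteq> set xs" "sorted xs"
    and "a ` set xs \<subseteq> carrier G"
    and "\<And>i. i \<in> set xs \<Longrightarrow> 0 < n i"
    and "\<And>i. i \<in> set xs \<Longrightarrow> a i [^] n i = \<one>"
  shows "list_product G a w \<in> ordered_power_products G a n xs"
  using assms
proof (induction xs arbitrary: w)
  case (Cons i xs)
  note hyps = Cons.prems(3-)
  \<comment> \<open>A word over the tail \<open>xs\<close> receives exponent 0 at \<open>i\<close>,
    which is in range because \<open>n i\<close> is positive.\<close>
  have skip: "list_product G a w \<in> ordered_power_products G a n (i # xs)"
    if "sorted w" "set w \<subseteq> set xs" for w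
  proof -
    have "list_product G a w \<in> ordered_power_products G a n xs"
      using that hyps by (intro Cons.IH) auto
    moreover have "list_product G a w = a i [^] (0::nat) \<otimes> list_product G a w"
      using that hyps(2) list_product_closed[of a w] by (subst nat_pow_0, subst l_one) auto
    ultimately show ?thesis using hyps(3)[of i]
      by (auto intro!: image_eqI[of _ _ "(0, list_product G a w)"])
  qed
  show ?case using Cons.prems(1,2)
  proof (induction w)
    case Nil
    then show ?case using skip[of "[]"] by simp
  next
    case (Cons j w)
    show ?case
    proof (cases "j = i")
      case True
      have "list_product G a w \<in> ordered_power_products G a n (i # xs)"
        using Cons by simp
      then obtain c g where c: "list_product G a w = a i [^] (c::nat) \<otimes> g"
          "g \<in> ordered_power_products G a n xs"
        by auto
      have ai: "a i \<in> carrier G" using hyps by simp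
      have g: "g \<in> carrier G" using c(2) ordered_power_products_subset hyps(2) by auto
      \<comment> \<open>One more factor \<open>a i\<close> may push the exponent up to
        \<open>n i\<close>, so it is reduced modulo \<open>n i\<close>.\<close>
      have "a i [^] Suc c = a i [^] (Suc c mod n i + n i * (Suc c div n i))"
        by (simp only: mod_mult_div_eq)
      also have "\<dots> = a i [^] (Suc c mod n i) \<otimes> (a i [^] n i) [^] (Suc c div n i)"
        by (simp only: nat_pow_mult[OF ai] nat_pow_pow[OF ai])
      also have "\<dots> = a i [^] (Suc c mod n i)"
        using ai by (subst hyps(4)) simp_all
      finally have reduce: "a i [^] Suc c = a i [^] (Suc c mod n i)" .
      have "list_product G a (j # w) = (a i \<otimes> a i [^] c) \<otimes> g"
        using True c(1) ai g by (simp add: m_assoc)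
      also have "a i \<otimes> a i [^] c = a i [^] Suc c"
        by (rule nat_pow_Suc2[OF ai, symmetric])
      finally have "list_product G a (j # w) = a i [^] (Suc c mod n i) \<otimes> g"
        unfolding reduce .
      moreover have "Suc c mod n i < n i" using hyps(3)[of i] by simp
      ultimately show ?thesis using c(2)
        by (auto intro!: image_eqI[of _ _ "(Suc c mod n i, g)"])
    next
      case False
      \<comment> \<open>Here \<open>j\<close> is strictly above \<open>i\<close>, the least entry of
        \<open>i # xs\<close>, and by sortedness so are all later letters.\<close>
      then have "i \<notin> set (j # w)" using Cons.prems hyps(1) by fastforce
      then show ?thesis using Cons.prems by (intro skip) auto
    qed
  qed
qed simp

text \<open>The letter \<open>j\<close> passes a letter \<open>i\<close> on its left by
  \<open>a i * a j = a j * a l\<close>, where \<open>a l\<close> is the conjugate of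
  \<open>a i\<close> by \<open>a j\<close>, again a letter's value by closure under conjugation.
  Passed letters may change, but their number does not.\<close>

lemma list_product_move_to_front:
  assumes a: "a ` X \<subseteq> carrier G"
    and conj: "\<And>i j. i \<in> X \<Longrightarrow> j \<in> X \<Longrightarrow> inv (a j) \<otimes> a i \<otimes> a j \<in> a ` X"
    and "j \<in> set w" "set w \<subseteq> X"
  shows "\<exists>w'. set w' \<subseteq> X \<and> length w = Suc (length w') \<and>
    list_product G a w = list_product G a (j # w')"
  using assms(3,4)
proof (induction w)
  case (Cons i w)
  show ?case
  proof (cases "i = j")
    case True
    then show ?thesis using Cons.prems by auto
  next
    case False
    then obtain w' where w': "set w' \<subseteq> X" "length w = Suc (length w')"
        "list_product G a w = list_product G a (j # w')"
      using Cons by auto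
    obtain l where l: "l \<in> X" "inv (a j) \<otimes> a i \<otimes> a j = a l"
      using conj[of i j] Cons.prems by (auto simp: image_iff)
    have [simp]: "a i \<in> carrier G" "a j \<in> carrier G" "a l \<in> carrier G"
        "list_product G a w' \<in> carrier G"
      using Cons.prems a w'(1) l by auto
    have "a i \<otimes> a j = a j \<otimes> a l"
      by (simp add: m_assoc flip: l(2))
    then have "a i \<otimes> list_product G a (j # w') = list_product G a (j # l # w')"
      by (simp flip: m_assoc)
    then show ?thesis using w' l by (intro exI[of _ "l # w'"]) simp
  qed
qed simp

text \<open>Choosing the least letter that occurs in any word of the given length and product,
  and moving it to the front, leaves a remainder whose sorted form cannot contain a smaller letter.\<close>

lemma list_product_sort:
  fixes X :: "'i::wellorder set"
  assumes a: "a ` X \<subseteq> carrier G"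
    and conj: "\<And>i j. i \<in> X \<Longrightarrow> j \<in> X \<Longrightarrow> inv (a j) \<otimes> a i \<otimes> a j \<in> a ` X"
    and "set w \<subseteq> X"
  shows "\<exists>w'. sorted w' \<and> set w' \<subseteq> X \<and> length w' = length w \<and>
    list_product G a w' = list_product G a w"
  using assms(3)
proof (induction "length w" arbitrary: w)
  case (Suc l)
  define P where "P j \<longleftrightarrow> (\<exists>v. j \<in> set v \<and> set v \<subseteq> X \<and> length v = length w \<and>
    list_product G a v = list_product G a w)" for j
  define j where "j = (LEAST j. P j)"
  have "P (hd w)" unfolding P_def using Suc by (intro exI[of _ w]) (cases w; auto)
  then have "P j" unfolding j_def by (rule LeastI)
  then obtain v where v: "j \<in> set v" "set v \<subseteq> X" "length v = length w"
      "list_product G a v = list_product G a w"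
    unfolding P_def by auto
  obtain v' where v': "set v' \<subseteq> X" "length v = Suc (length v')"
      "list_product G a v = list_product G a (j # v')"
    using list_product_move_to_front[OF a conj v(1,2)] by auto
  obtain u where u: "sorted u" "set u \<subseteq> X" "length u = length v'"
      "list_product G a u = list_product G a v'"
    using Suc.hyps(1)[of v'] Suc.hyps(2) v(3) v' by auto
  have "j \<le> i" if "i \<in> set u" for i
  proof -
    \<comment> \<open>The word \<open>j # u\<close> has the length and the product of
      \<open>w\<close>, so each letter of \<open>u\<close> competed in the choice of
      \<open>j\<close>.\<close>
    have "P i" unfolding P_def
      using that u v v' by (intro exI[of _ "j # u"]) auto
    then show ?thesis unfolding j_def by (rule Least_le)
  qed
  then show ?case using u v v' by (intro exI[of _ "j # u"]) auto
qed auto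

text \<open>Torsion makes inverses into positive powers, so every element is the product of a word;
  sorting the word puts it among finitely many ordered power products. The family \<open>e\<close>
  may repeat values, so that the bound can have one factor per index, here later one per quandle
  element.\<close>

theorem dietzmann:
  assumes X: "finite X" and e: "e ` X \<subseteq> carrier G"
    and conj: "\<And>x y. x \<in> X \<Longrightarrow> y \<in> X \<Longrightarrow> inv (e y) \<otimes> e x \<otimes> e y \<in> e ` X"
    and pos: "\<And>x. x \<in> X \<Longrightarrow> 0 < n x"
    and torsion: "\<And>x. x \<in> X \<Longrightarrow> e x [^] (n x :: nat) = \<one>"
    and gen: "generate G (e ` X) = carrier G"
  shows "finite (carrier G)" and "order G \<le> prod n X"
proof -
  \<comment> \<open>Sorting needs a well-order on the letters; enumerating \<open>X\<close> by
    natural numbers supplies it, and \<open>a\<close> is the family \<open>e\<close> relabelled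
    along the enumeration.\<close>
  obtain h where h: "bij_betw h {0..<card X} X"
    using ex_bij_betw_nat_finite[OF X] by auto
  define m where "m = card X"
  define a where "a = e \<circ> h"
  have img: "h ` {0..<m} = X" using h by (simp add: bij_betw_def m_def)
  have aX: "a ` {0..<m} = e ` X" by (simp add: a_def img flip: image_image image_comp)
  have hX: "h i \<in> X" if "i < m" for i using img that by auto
  have acl: "a ` {0..<m} \<subseteq> carrier G" using aX e by simp
  have aconj: "inv (a j) \<otimes> a i \<otimes> a j \<in> a ` {0..<m}" if "i \<in> {0..<m}" "j \<in> {0..<m}" for i j
    unfolding aX using that by (simp add: a_def conj hX)
  have word: "\<exists>w. set w \<subseteq> {0..<m} \<and> list_product G a w = g" if "g \<in> carrier G" for g
    using that unfolding gen[symmetric]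
  proof (induction rule: generate.induct)
    case one
    show ?case by (intro exI[of _ "[]"]) simp
  next
    case (incl g)
    then obtain i where "i < m" "g = a i" unfolding aX[symmetric] by auto
    moreover from this have "a i \<in> carrier G" using acl by auto
    ultimately show ?case by (intro exI[of _ "[i]"]) auto
  next
    case (inv g)
    then obtain i where i: "i < m" "g = a i" unfolding aX[symmetric] by auto
    have ai: "a i \<in> carrier G" using i acl by auto
    \<comment> \<open>With \<open>c\<close> one less than the torsion exponent, the power
      \<open>a i ^ c\<close> is the inverse of \<open>a i\<close>, so a word without inverse letters
      represents it.\<close>
    obtain c where c: "n (h i) = Suc c" using pos[OF hX[OF i(1)]] gr0_conv_Suc by auto
    have "a i [^] c \<otimes> a i = \<one>" using torsion[OF hX[OF i(1)]] c by (simp add: a_def)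
    then have "inv (a i) = a i [^] c" using ai by (intro inv_equality) auto
    then show ?case using i ai
      by (intro exI[of _ "replicate c i"]) (auto simp: list_product_replicate)
  next
    case (eng g1 g2)
    then obtain u v where "set u \<subseteq> {0..<m}" "list_product G a u = g1"
        "set v \<subseteq> {0..<m}" "list_product G a v = g2"
      by auto
    moreover from this have "a ` set u \<subseteq> carrier G" "a ` set v \<subseteq> carrier G"
      using acl by blast+
    ultimately show ?case by (intro exI[of _ "u @ v"]) (auto simp: list_product_append)
  qed
  have sub: "carrier G \<subseteq> ordered_power_products G a (n \<circ> h) [0..<m]"
  proof
    fix g assume "g \<in> carrier G"
    then obtain w where "set w \<subseteq> {0..<m}" "list_product G a w = g" using word by auto
    then obtain w' where w': "sorted w'" "set w' \<subseteq> {0..<m}" "list_product G a w' = g"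
      using list_product_sort[OF acl aconj, of w] by auto
    have "list_product G a w' \<in> ordered_power_products G a (n \<circ> h) [0..<m]"
    proof (rule list_product_sorted_in_ordered_power_products)
      show "a i [^] (n \<circ> h) i = \<one>" if "i \<in> set [0..<m]" for i
        using that torsion[OF hX[of i]] by (simp add: a_def)
    qed (use w' acl pos hX in auto)
    then show "g \<in> ordered_power_products G a (n \<circ> h) [0..<m]" using w'(3) by simp
  qed
  show "finite (carrier G)" using finite_subset[OF sub finite_ordered_power_products] .
  have "order G \<le> card (ordered_power_products G a (n \<circ> h) [0..<m])"
    unfolding order_def by (rule card_mono[OF finite_ordered_power_products sub])
  also have "\<dots> \<le> prod_list (map (n \<circ> h) [0..<m])" by (rule card_ordered_power_products_le)
  also have "\<dots> = prod (n \<circ> h) {0..<m}" by (simp flip: prod.distinct_set_conv_list)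
  also have "\<dots> = prod n X" using prod.reindex_bij_betw[OF h, of n] by (simp add: m_def)
  finally show "order G \<le> prod n X" .
qed

end

section \<open>Presented groups\<close>

lemma words_simps [simp]:
  "[] \<in> words S"
  "l # w \<in> words S \<longleftrightarrow> set_letter l \<subseteq> S \<and> w \<in> words S"
  "u @ v \<in> words S \<longleftrightarrow> u \<in> words S \<and> v \<in> words S"
  by (auto simp: words_def)

lemma word_inv_simps [simp]:
  "word_inv [] = []"
  "word_inv (l # w) = word_inv w @ [flip_letter l]"
  by (simp_all add: word_inv_def)

lemma set_letter_flip [simp]: "set_letter (flip_letter l) = set_letter l"
  by (cases l) simp_all

lemma word_inv_in_words [simp]: "word_inv w \<in> words S \<longleftrightarrow> w \<in> words S"
  by (induction w) auto

lemma replicate_in_words: "i \<in> S \<Longrightarrow> replicate c (Pos i) \<in> words S"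
  by (induction c) auto

lemma gcong_in_words:
  assumes "gcong S T u v" "T \<subseteq> words S"
  shows "u \<in> words S" "v \<in> words S"
  using assms by (induction rule: gcong.induct) auto

lemma gcong_letter_cancel:
  "set_letter l \<subseteq> S \<Longrightarrow> gcong S T [flip_letter l, l] []"
  by (cases l) (auto intro: gcong.cancel gcong.cancel')

lemma gcong_word_inv_append:
  "w \<in> words S \<Longrightarrow> gcong S T (word_inv w @ w) []"
proof (induction w)
  case Nil
  then show ?case by (simp add: gcong.refl)
next
  case (Cons l w)
  then have w: "w \<in> words S" by simp
  have "gcong S T ([flip_letter l, l] @ w) ([] @ w)"
    using Cons.prems w by (intro gcong.cong_append[OF gcong_letter_cancel gcong.refl]) simp_all
  then have "gcong S T (word_inv w @ ([flip_letter l, l] @ w)) (word_inv w @ ([] @ w))"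
    using w by (intro gcong.cong_append[OF gcong.refl]) simp_all
  then show ?case using Cons.IH[OF w] gcong.trans by auto
qed

locale presentation =
  fixes S :: "'g set" and T :: "'g word set"
  assumes relators: "T \<subseteq> words S"
begin

abbreviation "G \<equiv> presented_group S T"
abbreviation "cls \<equiv> gclass S T"

lemma gclass_eq_iff:
  assumes "u \<in> words S"
  shows "cls u = cls v \<longleftrightarrow> gcong S T u v"
  using assms unfolding gclass_def
  by (auto intro: gcong.refl gcong.sym gcong.trans)

lemma gclass_eqI: "gcong S T u v \<Longrightarrow> cls u = cls v"
  using gclass_eq_iff gcong_in_words(1) relators by blast

lemma carrier_presented_group: "carrier G = cls ` words S"
  by (simp add: presented_group_def)

lemma gclass_closed [simp]: "w \<in> words S \<Longrightarrow> cls w \<in> carrier G"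
  by (simp add: carrier_presented_group)

lemma one_presented_group: "\<one>\<^bsub>G\<^esub> = cls []"
  by (simp add: presented_group_def)

text \<open>Congruence makes all classes in the union that defines the product coincide, and the
  union is nonempty since a class contains its representative.\<close>

lemma mult_gclass [simp]:
  assumes "u \<in> words S" "v \<in> words S"
  shows "cls u \<otimes>\<^bsub>G\<^esub> cls v = cls (u @ v)"
proof -
  have "cls (a @ b) = cls (u @ v)" if "a \<in> cls u" "b \<in> cls v" for a b
    using that by (intro gclass_eqI gcong.cong_append) (auto simp: gclass_def intro: gcong.sym)
  moreover have "u \<in> cls u" "v \<in> cls v"
    using assms by (auto simp: gclass_def intro: gcong.refl)
  ultimately have "(\<Union>a \<in> cls u. \<Union>b \<in> cls v. cls (a @ b)) = cls (u @ v)" by blast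
  then show ?thesis by (simp add: presented_group_def)
qed

lemma group_presented_group: "group G"
proof (rule groupI)
  fix x assume "x \<in> carrier G"
  then obtain w where w: "w \<in> words S" "x = cls w" by (auto simp: carrier_presented_group)
  then have "cls (word_inv w) \<otimes>\<^bsub>G\<^esub> x = \<one>\<^bsub>G\<^esub>"
    by (simp add: one_presented_group gclass_eqI gcong_word_inv_append)
  then show "\<exists>y \<in> carrier G. y \<otimes>\<^bsub>G\<^esub> x = \<one>\<^bsub>G\<^esub>" using w by (meson gclass_closed word_inv_in_words)
qed (auto simp: carrier_presented_group one_presented_group)

sublocale group G by (rule group_presented_group)

lemma inv_gclass [simp]: "w \<in> words S \<Longrightarrow> inv\<^bsub>G\<^esub> (cls w) = cls (word_inv w)"
  by (intro inv_equality) (simp_all add: one_presented_group gclass_eqI gcong_word_inv_append)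

lemma gclass_relator: "r \<in> T \<Longrightarrow> cls r = \<one>\<^bsub>G\<^esub>"
  by (simp add: one_presented_group gclass_eqI gcong.relator)

lemma pow_gclass_Pos: "i \<in> S \<Longrightarrow> cls [Pos i] [^]\<^bsub>G\<^esub> (c::nat) = cls (replicate c (Pos i))"
  by (induction c) (simp_all add: one_presented_group replicate_in_words replicate_append_same)

lemma generate_gclass_Pos: "generate G ((\<lambda>i. cls [Pos i]) ` S) = carrier G"
proof
  show "generate G ((\<lambda>i. cls [Pos i]) ` S) \<subseteq> carrier G"
    by (rule generate_incl) auto
  have "cls w \<in> generate G ((\<lambda>i. cls [Pos i]) ` S)" if "w \<in> words S" for w
    using that
  proof (induction w)
    case Nil
    then show ?case using generate.one[of G] by (simp add: one_presented_group)
  next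
    case (Cons l w)
    have "cls [l] \<in> generate G ((\<lambda>i. cls [Pos i]) ` S)"
    proof (cases l)
      case (Pos i)
      then show ?thesis using Cons.prems by (auto intro: generate.incl)
    next
      case (Neg i)
      then have "i \<in> S" using Cons.prems by simp
      then show ?thesis
        using generate.inv[of "cls [Pos i]" "(\<lambda>i. cls [Pos i]) ` S" G] Neg by simp
    qed
    then have "cls [l] \<otimes>\<^bsub>G\<^esub> cls w \<in> generate G ((\<lambda>i. cls [Pos i]) ` S)"
      using Cons by (intro generate.eng) simp_all
    moreover have "cls [l] \<otimes>\<^bsub>G\<^esub> cls w = cls (l # w)"
      using Cons.prems by (subst mult_gclass) simp_all
    ultimately show ?case by simp
  qed
  then show "carrier G \<subseteq> generate G ((\<lambda>i. cls [Pos i]) ` S)"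
    by (auto simp: carrier_presented_group)
qed

end

section \<open>Quandles and their components\<close>

context quandle
begin

lemma qpow_append: "qpow Q x (u @ v) = qpow Q (qpow Q x u) v"
  by (induction Q x u rule: qpow.induct) auto

lemma qpow_word_inv:
  "x \<in> carrier Q \<Longrightarrow> w \<in> words (carrier Q) \<Longrightarrow> qpow Q (qpow Q x w) (word_inv w) = x"
proof (induction w arbitrary: x)
  case (Cons l w)
  then show ?case
    by (cases l) (auto simp: qpow_append rhd_closed rhd_inv_closed A2)
qed simp

lemma equiv_same_component: "equiv (carrier Q) (same_component Q)"
proof (rule equivI)
  show "same_component Q \<subseteq> carrier Q \<times> carrier Q"
    by (auto simp: same_component_def)
  show "refl_on (carrier Q) (same_component Q)"
    by (auto simp: refl_on_def same_component_def intro!: bexI[of _ "[]"])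
  show "Relation.sym (same_component Q)"
    by (auto simp: Relation.sym_def same_component_def qpow_word_inv intro!: bexI[of _ "word_inv _"])
  show "Relation.trans (same_component Q)"
  proof (rule transI)
    fix x y z assume xy: "(x, y) \<in> same_component Q" and yz: "(y, z) \<in> same_component Q"
    then obtain u v where "u \<in> words (carrier Q)" "qpow Q x u = y"
        "v \<in> words (carrier Q)" "qpow Q y v = z"
      by (auto simp: same_component_def)
    then show "(x, z) \<in> same_component Q"
      using xy yz by (auto simp: same_component_def qpow_append intro!: bexI[of _ "u @ v"])
  qed
qed

lemma same_component_rhd:
  "x \<in> carrier Q \<Longrightarrow> y \<in> carrier Q \<Longrightarrow> (x, x \<rhd> y) \<in> same_component Q"
  by (auto simp: same_component_def rhd_closed intro!: bexI[of _ "[Pos y]"])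

lemma same_component_rhd_inv:
  "x \<in> carrier Q \<Longrightarrow> y \<in> carrier Q \<Longrightarrow> (x, x \<rhd>\<^sup>-\<^sup>1 y) \<in> same_component Q"
  by (auto simp: same_component_def rhd_inv_closed intro!: bexI[of _ "[Neg y]"])

lemma qeval_closed: "q ` S \<subseteq> carrier Q \<Longrightarrow> set_qterm t \<subseteq> S \<Longrightarrow> qeval Q q t \<in> carrier Q"
  by (induction t) (auto simp: rhd_closed rhd_inv_closed)

lemma qeval_term_pow:
  "qeval Q q (term_pow t w) = qpow Q (qeval Q q t) (map (map_letter q) w)"
  by (induction t w rule: term_pow.induct) auto

lemma set_qterm_term_pow: "set_qterm (term_pow t w) = set_qterm t \<union> (\<Union>l \<in> set w. set_letter l)"
  by (induction t w rule: term_pow.induct) auto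

text \<open>One direction of the universal property of the presented quandle: congruent terms
  evaluate equally wherever the quandle axioms and the relations hold. The target of interest is the
  conjugation quandle of the group, where this makes the map \<open>e\<close> well defined.\<close>

lemma qcong_sound:
  assumes "qcong S R t u"
    and q: "q ` S \<subseteq> carrier Q"
    and R: "\<And>a w b. (a, w, b) \<in> R \<Longrightarrow> a \<in> S \<and> w \<in> words S \<and> b \<in> S"
    and relations: "\<And>a w b. (a, w, b) \<in> R \<Longrightarrow> qpow Q (q a) (map (map_letter q) w) = q b"
  shows "set_qterm t \<subseteq> S \<and> set_qterm u \<subseteq> S \<and> qeval Q q t = qeval Q q u"
  using assms(1)
proof (induction rule: qcong.induct)
  case (relation a w b)
  then show ?case
    using R[OF relation] relations[OF relation]
    by (auto simp: qeval_term_pow set_qterm_term_pow words_def)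
qed (auto simp: A1 A2 A3 qeval_closed[OF q])

end

lemma ordered_components_index:
  assumes "quandle Q" "ordered_components Q k C" "x \<in> carrier Q"
  shows "\<exists>j \<in> {1..k}. x \<in> C j"
proof -
  interpret quandle Q by fact
  have "same_component Q `` {x} \<in> C ` {1..k}"
    using assms quotientI[OF assms(3)]
    by (simp add: ordered_components_def algebraic_components_def bij_betw_def)
  then show ?thesis using equiv_class_self[OF equiv_same_component assms(3)] by auto
qed

lemma ordered_components_mem_iff:
  assumes "quandle Q" "ordered_components Q k C" "j \<in> {1..k}" "(x, y) \<in> same_component Q"
  shows "x \<in> C j \<longleftrightarrow> y \<in> C j"
proof -
  interpret quandle Q by fact
  have "C j \<in> carrier Q // same_component Q"
    using assms(2,3) by (auto simp: ordered_components_def algebraic_components_def bij_betw_def)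
  then show ?thesis
    using assms(4) in_quotient_imp_closed[OF equiv_same_component] equivE[OF equiv_same_component]
    by (metis symE)
qed

text \<open>The function \<open>c\<close> picks a component index for every element. As components
  are disjoint and \<open>C\<close> is injective, the fibre of \<open>c\<close> over
  \<open>j\<close> is \<open>C j\<close>; grouping the factors by fibres gives the powers.\<close>

lemma prod_ordered_components:
  fixes f :: "nat \<Rightarrow> nat"
  assumes "quandle Q" "ordered_components Q k C" "finite (carrier Q)"
    and c: "\<And>x. x \<in> carrier Q \<Longrightarrow> c x \<in> {1..k} \<and> x \<in> C (c x)"
  shows "(\<Prod>x \<in> carrier Q. f (c x)) = (\<Prod>j = 1..k. f j ^ card (C j))"
proof -
  interpret quandle Q by fact
  have C: "C j \<in> carrier Q // same_component Q" if "j \<in> {1..k}" for j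
    using assms(2) that by (auto simp: ordered_components_def algebraic_components_def bij_betw_def)
  have inj: "inj_on C {1..k}"
    using assms(2) by (simp add: ordered_components_def bij_betw_def)
  have fibre: "{x \<in> carrier Q. c x = j} = C j" if j: "j \<in> {1..k}" for j
  proof (intro subset_antisym subsetI)
    fix x assume x: "x \<in> C j"
    then have xQ: "x \<in> carrier Q" using C[OF j] in_quotient_imp_subset[OF equiv_same_component] by auto
    then have "C (c x) = C j"
      using quotient_disj[OF equiv_same_component C[of "c x"] C[OF j]] c[OF xQ] x by blast
    then have "c x = j" using inj_onD[OF inj] c[OF xQ] j by blast
    then show "x \<in> {x \<in> carrier Q. c x = j}" using xQ by simp
  qed (use c in auto)
  have "(\<Prod>x \<in> carrier Q. f (c x)) = (\<Prod>j = 1..k. \<Prod>x \<in> {x \<in> carrier Q. c x = j}. f (c x))"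
    using assms(3) c by (intro prod.group[symmetric]) auto
  also have "\<dots> = (\<Prod>j = 1..k. f j ^ card (C j))"
  proof (rule prod.cong[OF HOL.refl])
    fix j assume j: "j \<in> {1..k}"
    have "(\<Prod>x \<in> {x \<in> carrier Q. c x = j}. f (c x)) = (\<Prod>x \<in> {x \<in> carrier Q. c x = j}. f j)"
      by (rule prod.cong) auto
    then show "(\<Prod>x \<in> {x \<in> carrier Q. c x = j}. f (c x)) = f j ^ card (C j)"
      by (simp only: fibre[OF j] prod_constant)
  qed
  finally show ?thesis .
qed

section \<open>The conjugation quandle of a group\<close>

text \<open>The inverse stands on the left in \<open>rhd\<close> to agree with the right action of
  words and with the shape of \<open>conj_relator\<close>.\<close>

definition conj_quandle :: "('b, 'm) monoid_scheme \<Rightarrow> 'b quandle" where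
  "conj_quandle G = \<lparr>carrier = carrier G,
     rhd = (\<lambda>x y. inv\<^bsub>G\<^esub> y \<otimes>\<^bsub>G\<^esub> x \<otimes>\<^bsub>G\<^esub> y), rhd_inv = (\<lambda>x y. y \<otimes>\<^bsub>G\<^esub> x \<otimes>\<^bsub>G\<^esub> inv\<^bsub>G\<^esub> y)\<rparr>"

lemma conj_quandle_simps [simp]:
  "carrier (conj_quandle G) = carrier G"
  "x \<rhd>\<^bsub>conj_quandle G\<^esub> y = inv\<^bsub>G\<^esub> y \<otimes>\<^bsub>G\<^esub> x \<otimes>\<^bsub>G\<^esub> y"
  "x \<rhd>\<^sup>-\<^sup>1\<^bsub>conj_quandle G\<^esub> y = y \<otimes>\<^bsub>G\<^esub> x \<otimes>\<^bsub>G\<^esub> inv\<^bsub>G\<^esub> y"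
  by (simp_all add: conj_quandle_def)

context group
begin

lemma quandle_conj_quandle: "quandle (conj_quandle G)"
  by unfold_locales (auto simp: m_assoc inv_mult_group)

lemma pow_conjugate:
  "x \<in> carrier G \<Longrightarrow> y \<in> carrier G \<Longrightarrow> (inv y \<otimes> x \<otimes> y) [^] (c::nat) = inv y \<otimes> x [^] c \<otimes> y"
  by (induction c) (auto simp: m_assoc)

lemma pow_conjugate_eq_one:
  assumes "x \<in> carrier G" "y \<in> carrier G" "x [^] (c::nat) = \<one>"
  shows "(inv y \<otimes> x \<otimes> y) [^] c = \<one>" "(y \<otimes> x \<otimes> inv y) [^] c = \<one>"
  using pow_conjugate[of x y c] pow_conjugate[of x "inv y" c] assms by simp_all

end

text \<open>Conjugating by the letters in turn is conjugating by the whole word. This links quandle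
  relations in \<open>conj_quandle G\<close> with the group relators
  \<open>conj_relator\<close>.\<close>

lemma (in presentation) qpow_conj_quandle_gclass:
  "v \<in> words S \<Longrightarrow> w \<in> words S \<Longrightarrow>
    qpow (conj_quandle G) (cls v) (map (map_letter (\<lambda>i. cls [Pos i])) w) =
    cls (word_inv w @ v @ w)"
proof (induction w arbitrary: v)
  case (Cons l w)
  then show ?case by (cases l) simp_all
qed simp

theorem theorem2p2:
  fixes Q :: "('a, 'm) quandle_scheme"
    and k :: nat and C :: "nat \<Rightarrow> 'a set" and n :: "nat \<Rightarrow> nat"
    and s :: nat and q :: "nat \<Rightarrow> 'a" and R :: "nat qrel set"
  assumes "N_quandle Q k C n"
    and "finite (carrier Q)"
    and "finite R"
    and "presents_quandle Q {1..s} R q"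
  shows "group (Conj_N {1..s} R q k C n)
       \<and> finite (carrier (Conj_N {1..s} R q k C n))
       \<and> order (Conj_N {1..s} R q k C n) \<le> (\<Prod>i = 1..k. n i ^ card (C i))"
proof -
  define S where "S = {1..s}"
  define T where "T = conj_relator ` R \<union> power_relators S q k C n"
  have Q: "quandle Q" and comps: "ordered_components Q k C"
    and npos: "\<And>i. i \<in> {1..k} \<Longrightarrow> n i > 0"
    using assms(1) by (auto simp: N_quandle_def)
  interpret quandle Q by fact
  have R: "a \<in> S \<and> w \<in> words S \<and> b \<in> S" if "(a, w, b) \<in> R" for a w b
    using assms(4) that by (auto simp: presents_quandle_def S_def)
  have surj: "qeval Q q ` {t. set_qterm t \<subseteq> S} = carrier Q"
    and qcong_iff: "\<And>t u. set_qterm t \<subseteq> S \<Longrightarrow> set_qterm u \<subseteq> S \<Longrightarrow>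
      qeval Q q t = qeval Q q u \<longleftrightarrow> qcong S R t u"
    using assms(4) by (auto simp: presents_quandle_def S_def)
  have qS: "q ` S \<subseteq> carrier Q"
  proof
    fix x assume "x \<in> q ` S"
    then obtain i where i: "i \<in> S" "x = qeval Q q (Gen i)" by auto
    then have "x \<in> qeval Q q ` {t. set_qterm t \<subseteq> S}" by (intro image_eqI[of _ _ "Gen i"]) simp_all
    then show "x \<in> carrier Q" by (simp add: surj)
  qed
  interpret presentation S T
    using R by unfold_locales
      (auto simp: T_def conj_relator_def power_relators_def replicate_in_words)
  interpret K: quandle "conj_quandle G" by (rule quandle_conj_quandle)
  define g where "g i = cls [Pos i]" for i
  have gS: "g ` S \<subseteq> carrier (conj_quandle G)" by (auto simp: g_def)
  \<comment> \<open>Triviality of \<open>conj_relator (a, w, b)\<close> says that conjugating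
    \<open>g a\<close> by \<open>w\<close> gives \<open>g b\<close>, which is the quandle relation
    read in the conjugation quandle.\<close>
  have relations: "qpow (conj_quandle G) (g a) (map (map_letter g) w) = g b"
    if "(a, w, b) \<in> R" for a w b
  proof -
    have abw: "a \<in> S" "w \<in> words S" "b \<in> S" using R[OF that] by auto
    have "cls (conj_relator (a, w, b)) = \<one>\<^bsub>G\<^esub>"
      using that by (intro gclass_relator) (auto simp: T_def)
    then have "cls (word_inv w @ [Pos a] @ w) \<otimes>\<^bsub>G\<^esub> inv\<^bsub>G\<^esub> (g b) = \<one>\<^bsub>G\<^esub>"
      using abw by (simp add: conj_relator_def g_def)
    then have "cls (word_inv w @ [Pos a] @ w) = \<one>\<^bsub>G\<^esub> \<otimes>\<^bsub>G\<^esub> g b"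
      using abw by (subst (asm) inv_solve_right') (simp_all add: g_def)
    then have "cls (word_inv w @ [Pos a] @ w) = g b"
      using abw by (simp add: g_def)
    then show ?thesis
      using abw qpow_conj_quandle_gclass[of "[Pos a]" w] by (simp add: g_def[abs_def])
  qed
  \<comment> \<open>The map \<open>e\<close> is defined through an arbitrary term for
    \<open>x\<close>; one exists because the generators generate \<open>Q\<close>.\<close>
  define rep where "rep x = (SOME t. set_qterm t \<subseteq> S \<and> qeval Q q t = x)" for x
  define e where "e x = qeval (conj_quandle G) g (rep x)" for x
  have rep: "set_qterm (rep x) \<subseteq> S \<and> qeval Q q (rep x) = x" if "x \<in> carrier Q" for x
    unfolding rep_def by (rule someI_ex) (use that in \<open>auto simp flip: surj\<close>)
  \<comment> \<open>Independence of the chosen term: terms with equal value in \<open>Q\<close> are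
    congruent by the presentation, hence have equal value in the conjugation quandle.\<close>
  have e_qeval: "e (qeval Q q t) = qeval (conj_quandle G) g t" if t: "set_qterm t \<subseteq> S" for t
  proof -
    have "qcong S R (rep (qeval Q q t)) t"
      using qcong_iff[of "rep (qeval Q q t)" t] rep[OF qeval_closed[OF qS t]] t by simp
    then show ?thesis unfolding e_def using K.qcong_sound[OF _ gS R relations] by auto
  qed
  have e_closed: "e x \<in> carrier G" if "x \<in> carrier Q" for x
    using K.qeval_closed[OF gS] rep[OF that] by (simp add: e_def)
  have e_rhd: "e (x \<rhd>\<^bsub>Q\<^esub> y) = inv\<^bsub>G\<^esub> (e y) \<otimes>\<^bsub>G\<^esub> e x \<otimes>\<^bsub>G\<^esub> e y"
    if "x \<in> carrier Q" "y \<in> carrier Q" for x y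
    using e_qeval[of "Rhd (rep x) (rep y)"] rep[OF that(1)] rep[OF that(2)] by (simp add: e_def)
  \<comment> \<open>The power relators concern generators only. Torsion spreads to all terms since
    either quandle operation keeps its left argument in the same component and conjugates its image
    in the group.\<close>
  have torsion: "qeval (conj_quandle G) g t [^]\<^bsub>G\<^esub> n j = \<one>\<^bsub>G\<^esub>"
    if "set_qterm t \<subseteq> S" "j \<in> {1..k}" "qeval Q q t \<in> C j" for t j
    using that
  proof (induction t)
    case (Gen i)
    then have "replicate (n j) (Pos i) \<in> T" by (auto simp: T_def power_relators_def)
    then show ?case using Gen by (simp add: g_def pow_gclass_Pos gclass_relator)
  next
    case (Rhd t u)
    then have "qeval Q q t \<in> C j"
      using ordered_components_mem_iff[OF Q comps _ same_component_rhd, of j "qeval Q q t" "qeval Q q u"]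
        qeval_closed[OF qS, of t] qeval_closed[OF qS, of u] by simp
    then show ?case
      using Rhd K.qeval_closed[OF gS, of t] K.qeval_closed[OF gS, of u]
      by (simp add: pow_conjugate_eq_one)
  next
    case (RhdInv t u)
    then have "qeval Q q t \<in> C j"
      using ordered_components_mem_iff[OF Q comps _ same_component_rhd_inv, of j "qeval Q q t" "qeval Q q u"]
        qeval_closed[OF qS, of t] qeval_closed[OF qS, of u] by simp
    then show ?case
      using RhdInv K.qeval_closed[OF gS, of t] K.qeval_closed[OF gS, of u]
      by (simp add: pow_conjugate_eq_one)
  qed
  obtain c where c: "\<And>x. x \<in> carrier Q \<Longrightarrow> c x \<in> {1..k} \<and> x \<in> C (c x)"
    using ordered_components_index[OF Q comps] by metis
  \<comment> \<open>Since \<open>g i\<close> is \<open>e (q i)\<close>, the image of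
    \<open>e\<close> contains the group generators.\<close>
  have "g i \<in> e ` carrier Q" if "i \<in> S" for i
    using e_qeval[of "Gen i"] that qS by (auto intro!: image_eqI[of _ _ "q i"])
  then have "generate G (g ` S) \<subseteq> generate G (e ` carrier Q)"
    by (intro mono_generate) auto
  then have gen: "generate G (e ` carrier Q) = carrier G"
    using generate_gclass_Pos generate_incl[of "e ` carrier Q"] e_closed
    by (auto simp: g_def[abs_def])
  have e_pow: "e x [^]\<^bsub>G\<^esub> n (c x) = \<one>\<^bsub>G\<^esub>" if "x \<in> carrier Q" for x
    unfolding e_def using torsion[of "rep x" "c x"] rep[OF that] c[OF that] by simp
  \<comment> \<open>The conjugate is the image under \<open>e\<close> of the quandle product of
    \<open>x\<close> and \<open>y\<close>.\<close>
  have e_conj: "inv\<^bsub>G\<^esub> (e y) \<otimes>\<^bsub>G\<^esub> e x \<otimes>\<^bsub>G\<^esub> e y \<in> e ` carrier Q"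
    if "x \<in> carrier Q" "y \<in> carrier Q" for x y
    using that by (simp add: rhd_closed flip: e_rhd)
  have e_img: "e ` carrier Q \<subseteq> carrier G" and c_pos: "\<And>x. x \<in> carrier Q \<Longrightarrow> 0 < n (c x)"
    using e_closed c npos by auto
  have "finite (carrier G)" and "order G \<le> (\<Prod>x \<in> carrier Q. n (c x))"
    using dietzmann[OF assms(2) e_img e_conj c_pos e_pow gen] by auto
  moreover have "(\<Prod>x \<in> carrier Q. n (c x)) = (\<Prod>i = 1..k. n i ^ card (C i))"
    by (rule prod_ordered_components[OF Q comps assms(2) c])
  moreover have "Conj_N {1..s} R q k C n = G"
    by (simp add: Conj_N_def S_def T_def)
  ultimately show ?thesis using group_presented_group by simp
qed

end
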